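(* Let $(\mathbb X,\mathsf d)$ be a metric space with the Besicovitch property, let $\mu\in\mathscr F^*$ and $\nu\in\mathscr F$. Let $\varphi$ be the function of $t\in\mathbb R$ given by $\varphi(t)=B_{(\mu,\nu),\mathrm S_\mu}(t,1)$ (or, alternatively, by $\varphi(t)=\tau_{(\mu,\nu),\mathrm S_\mu}(t,1)$). Assume that $\varphi(0)=0$ and $\nu^\sharp(\mathrm S_\mu)>0$, and let $\varphi'_l(0),\varphi'_r(0)$ be the left and right derivatives of $\varphi$ at $0$. Put $X=X_\mu\bigl(-\varphi'_r(0),-\varphi'_l(0)\bigr)$. Then $$\dim_H X\ \ge\ \inf\Bigl\{\liminf_{r\searrow0}\frac{\log\nu(\mathsf B(x,r))}{\log r}\ ;\ x\in X\Bigr\}$$ and $$\dim_P X\ \ge\ \inf\Bigl\{\limsup_{r\searrow0}\frac{\log\nu(\mathsf B(x,r))}{\log r}\ ;\ x\in X\Bigr\}.$$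
   Context: Besicovitch property: there is an integer constant $C_B$ such that from any collection $\mathcal B$ of balls one can extract $C_B$ countable families $\{\mathsf B_{j,k}\}_k$, $1\le j\le C_B$, such that $\bigcup_{j,k}\mathsf B_{j,k}$ contains the centers of all elements of $\mathcal B$ and, for each $j$, the balls $\mathsf B_{j,k}$ ($k$ varying) are pairwise disjoint. $\mathsf B(x,r)$ is the open ball; in a collection of balls $\{\mathsf B_j\}$, $\mathsf B_j=\mathsf B(x_j,r_j)$. $\mathscr B$ is the set of balls of $\mathbb X$, $\mathscr F$ the set of maps $\mathscr B\to[0,+\infty)$, and $\mathscr F^*$ the set of $\mu\in\mathscr F$ such that $\mu(\mathsf B)=0$ implies $\mu(\mathsf B')=0$ for all balls $\mathsf B'\subset\mathsf B$. For $\mu\in\mathscr F^*$, $\mathrm S_\mu$ is the complement of $\bigcup\{\mathsf B\in\mathscr B;\ \mu(\mathsf B)=0\}$. For $\nu\in\mathscr F$, $\nu^\sharp(E)=\inf\{\sum\nu(\mathsf B_j);\ E\subset\bigcup\mathsf B_j\}$ (outer measure). $\dim_H,\dim_P$ are the Hausdorff and (Tricot) packing dimensions. Level sets: $$X_\mu(\alpha,\beta)=\Bigl\{x\in\mathrm S_\mu;\ \alpha\le\liminf_{r\searrow0}\tfrac{\log\mu(\mathsf B(x,r))}{\log r}\ \text{and}\ \limsup_{r\searrow0}\tfrac{\log\mu(\mathsf B(x,r))}{\log r}\le\beta\Bigr\}.$$ A $\delta$-packing of $E$ is a collection of pairwise disjoint balls centered in $E$ with radii $\le\delta$. For $(q_1,q_2)\in\mathbb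 R^2$, $s\in\mathbb R$, $\delta>0$, $E\subset\mathbb X$, $$\overline{\mathscr P}^{(q_1,q_2),s}_{(\mu,\nu),\delta}(E)=\sup\Bigl\{\sum\nolimits^{*} r_j^s\mu(\mathsf B_j)^{q_1}\nu(\mathsf B_j)^{q_2};\ \{\mathsf B_j\}\ \delta\text{-packing of }E\Bigr\},$$ where $*$ means summing only the terms with $\mu(\mathsf B_j)\nu(\mathsf B_j)\ne0$; $\overline{\mathscr P}^{q,s}_{(\mu,\nu)}(E)=\lim_{\delta\searrow0}\overline{\mathscr P}^{q,s}_{(\mu,\nu),\delta}(E)$; $\mathscr P^{q,s}_{(\mu,\nu)}(E)=\inf\{\sum_j\overline{\mathscr P}^{q,s}_{(\mu,\nu)}(E_j);\ E\subset\bigcup_jE_j\}$ (countable covers). Then $\tau_{(\mu,\nu),E}(q)=\inf\{s\in\mathbb R;\ \overline{\mathscr P}^{q,s}_{(\mu,\nu)}(E)=0\}$ and $B_{(\mu,\nu),E}(q)=\inf\{s\in\mathbb R;\ \mathscr P^{q,s}_{(\mu,\nu)}(E)=0\}$. These are convex functions of $q$; one-sided derivatives are understood in $[-\infty,+\infty]$. *)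

theory Defs
  imports "HOL-Analysis.Analysis"
begin

text \<open>
  A ball as a member of a collection carries a center and a radius, which the underlying point set
  need not determine; collections of balls are therefore sets of pairs \<open>(x, r)\<close> with \<open>r > 0\<close>.
  A set function is evaluated on the open ball as a point set.
\<close>

abbreviation pball :: "'a::metric_space \<times> real \<Rightarrow> 'a set" where
  "pball b \<equiv> ball (fst b) (snd b)"

definition disjoint_balls :: "('a::metric_space \<times> real) set \<Rightarrow> bool" where
  "disjoint_balls P \<longleftrightarrow> pairwise (\<lambda>b c. pball b \<inter> pball c = {}) P"

text \<open>
  As in the Besicovitch covering theorem, the radii of the collection are bounded (with \<open>C\<close>
  independent of the bound). Without a bound on the radii the property would fail in every unbounded
  space, the real line included: if \<open>d(x\<^sub>n, x\<^sub>0) \<rightarrow> \<infinity>\<close>, the balls \<open>B(x\<^sub>n, 2 d(x\<^sub>n, x\<^sub>0))\<close> all contain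
  \<open>x\<^sub>0\<close>, and finitely many of them cannot cover all the centers. The condition below is implied by
  the one without the bound.
\<close>

definition besicovitch_property :: "'a::metric_space itself \<Rightarrow> bool" where
  "besicovitch_property _ \<longleftrightarrow>
    (\<exists>C::nat. \<forall>\<B> :: ('a \<times> real) set.
      (\<forall>b\<in>\<B>. 0 < snd b) \<and> bdd_above (snd ` \<B>) \<longrightarrow>
      (\<exists>F :: nat \<Rightarrow> ('a \<times> real) set.
        (\<forall>j\<in>{1..C}. F j \<subseteq> \<B> \<and> countable (F j) \<and> disjoint_balls (F j)) \<and>
        fst ` \<B> \<subseteq> (\<Union>j\<in>{1..C}. \<Union>b\<in>F j. pball b)))"

definition balls :: "'a::metric_space set set" where
  "balls = {ball x r | x r. 0 < r}"

definition ball_funs :: "('a::metric_space set \<Rightarrow> real) set" where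
  "ball_funs = {\<mu>. \<forall>B\<in>balls. 0 \<le> \<mu> B}"

definition ball_funs_star :: "('a::metric_space set \<Rightarrow> real) set" where
  "ball_funs_star =
    {\<mu> \<in> ball_funs. \<forall>B\<in>balls. \<mu> B = 0 \<longrightarrow> (\<forall>B'\<in>balls. B' \<subseteq> B \<longrightarrow> \<mu> B' = 0)}"

definition supp :: "('a::metric_space set \<Rightarrow> real) \<Rightarrow> 'a set" where
  "supp \<mu> = - \<Union>{B \<in> balls. \<mu> B = 0}"

definition sharp :: "('a::metric_space set \<Rightarrow> real) \<Rightarrow> 'a set \<Rightarrow> ennreal" where
  "sharp \<nu> E =
    (INF \<C> \<in> {\<C>. countable \<C> \<and> (\<forall>b\<in>\<C>. 0 < snd b) \<and> E \<subseteq> (\<Union>b\<in>\<C>. pball b)}.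
      \<Sum>\<^sub>\<infinity>b\<in>\<C>. ennreal (\<nu> (pball b)))"

text \<open>Logarithm with \<open>log 0 = -\<infinity>\<close>; the library has \<open>ln 0 = 0\<close>.\<close>

definition elog :: "real \<Rightarrow> ereal" where
  "elog x = (if x = 0 then -\<infinity> else ereal (ln x))"

definition lower_local_dim :: "('a::metric_space set \<Rightarrow> real) \<Rightarrow> 'a \<Rightarrow> ereal" where
  "lower_local_dim \<mu> x = Liminf (at_right 0) (\<lambda>r. elog (\<mu> (ball x r)) / ereal (ln r))"

definition upper_local_dim :: "('a::metric_space set \<Rightarrow> real) \<Rightarrow> 'a \<Rightarrow> ereal" where
  "upper_local_dim \<mu> x = Limsup (at_right 0) (\<lambda>r. elog (\<mu> (ball x r)) / ereal (ln r))"

definition level_set :: "('a::metric_space set \<Rightarrow> real) \<Rightarrow> ereal \<Rightarrow> ereal \<Rightarrow> 'a set" where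
  "level_set \<mu> \<alpha> \<beta> = {x \<in> supp \<mu>. \<alpha> \<le> lower_local_dim \<mu> x \<and> upper_local_dim \<mu> x \<le> \<beta>}"

definition packings :: "real \<Rightarrow> 'a::metric_space set \<Rightarrow> ('a \<times> real) set set" where
  "packings \<delta> E = {P. (\<forall>b\<in>P. fst b \<in> E \<and> 0 < snd b \<and> snd b \<le> \<delta>) \<and> disjoint_balls P}"

text \<open>
  The packing construction for a general weight \<open>w\<close> on balls; it is used both for the mixed packing
  measures of \<open>(\<mu>, \<nu>)\<close> and, with weight \<open>r\<^sup>s\<close>, for the packing dimension.
\<close>

definition packing_pre_delta ::
    "('a::metric_space \<times> real \<Rightarrow> ennreal) \<Rightarrow> real \<Rightarrow> 'a set \<Rightarrow> ennreal" where
  "packing_pre_delta w \<delta> E = (SUP P \<in> packings \<delta> E. \<Sum>\<^sub>\<infinity>b\<in>P. w b)"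

definition packing_pre :: "('a::metric_space \<times> real \<Rightarrow> ennreal) \<Rightarrow> 'a set \<Rightarrow> ennreal" where
  "packing_pre w E = Lim (at_right 0) (\<lambda>\<delta>. packing_pre_delta w \<delta> E)"

definition packing_meas :: "('a::metric_space \<times> real \<Rightarrow> ennreal) \<Rightarrow> 'a set \<Rightarrow> ennreal" where
  "packing_meas w E = (INF A \<in> {A :: nat \<Rightarrow> 'a set. E \<subseteq> (\<Union>j. A j)}. \<Sum>j. packing_pre w (A j))"

text \<open>Balls with \<open>\<mu>(B) \<nu>(B) = 0\<close> get weight \<open>0\<close>, i.e. they are left out of the sums.\<close>

definition mixed_weight ::
    "('a::metric_space set \<Rightarrow> real) \<Rightarrow> ('a set \<Rightarrow> real) \<Rightarrow> real \<times> real \<Rightarrow> real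
      \<Rightarrow> 'a \<times> real \<Rightarrow> ennreal" where
  "mixed_weight \<mu> \<nu> q s b =
    (if \<mu> (pball b) * \<nu> (pball b) = 0 then 0
     else ennreal (snd b powr s * \<mu> (pball b) powr fst q * \<nu> (pball b) powr snd q))"

definition tau_fun ::
    "('a::metric_space set \<Rightarrow> real) \<Rightarrow> ('a set \<Rightarrow> real) \<Rightarrow> 'a set \<Rightarrow> real \<times> real \<Rightarrow> ereal" where
  "tau_fun \<mu> \<nu> E q = (INF s \<in> {s::real. packing_pre (mixed_weight \<mu> \<nu> q s) E = 0}. ereal s)"

definition B_fun ::
    "('a::metric_space set \<Rightarrow> real) \<Rightarrow> ('a set \<Rightarrow> real) \<Rightarrow> 'a set \<Rightarrow> real \<times> real \<Rightarrow> ereal" where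
  "B_fun \<mu> \<nu> E q = (INF s \<in> {s::real. packing_meas (mixed_weight \<mu> \<nu> q s) E = 0}. ereal s)"

definition packing_dim :: "'a::metric_space set \<Rightarrow> ereal" where
  "packing_dim E =
    (INF s \<in> {s::real. 0 \<le> s \<and> packing_meas (\<lambda>b. ennreal (snd b powr s)) E = 0}. ereal s)"

text \<open>
  \<open>diam(U)\<^sup>s\<close> with the usual conventions \<open>diam(\<emptyset>)\<^sup>s = 0\<close> for all \<open>s \<ge> 0\<close> and \<open>0\<^sup>0 = 1\<close> for nonempty
  sets, whereas the library has \<open>0 powr 0 = 0\<close>.
\<close>

definition diam_pow :: "real \<Rightarrow> 'a::metric_space set \<Rightarrow> ennreal" where
  "diam_pow s U = (if U = {} then 0 else if s = 0 then 1 else ennreal (diameter U powr s))"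

text \<open>
  Boundedness of the covering sets is required explicitly because \<open>diameter\<close> is real-valued and
  meaningless on unbounded sets.
\<close>

definition hausdorff_delta :: "real \<Rightarrow> real \<Rightarrow> 'a::metric_space set \<Rightarrow> ennreal" where
  "hausdorff_delta s \<delta> E =
    (INF U \<in> {U :: nat \<Rightarrow> 'a set. E \<subseteq> (\<Union>i. U i) \<and> (\<forall>i. bounded (U i) \<and> diameter (U i) \<le> \<delta>)}.
      \<Sum>i. diam_pow s (U i))"

definition hausdorff_meas :: "real \<Rightarrow> 'a::metric_space set \<Rightarrow> ennreal" where
  "hausdorff_meas s E = Lim (at_right 0) (\<lambda>\<delta>. hausdorff_delta s \<delta> E)"

definition hausdorff_dim :: "'a::metric_space set \<Rightarrow> ereal" where
  "hausdorff_dim E = (INF s \<in> {s::real. 0 \<le> s \<and> hausdorff_meas s E = 0}. ereal s)"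

text \<open>
  One-sided derivatives with values in \<open>[-\<infinity>, +\<infinity>]\<close>; the limits exist for convex \<open>f\<close> at points
  where \<open>f\<close> is finite.
\<close>

definition right_deriv :: "(real \<Rightarrow> ereal) \<Rightarrow> real \<Rightarrow> ereal" where
  "right_deriv f a = Lim (at_right a) (\<lambda>t. (f t - f a) / ereal (t - a))"

definition left_deriv :: "(real \<Rightarrow> ereal) \<Rightarrow> real \<Rightarrow> ereal" where
  "left_deriv f a = Lim (at_left a) (\<lambda>t. (f t - f a) / ereal (t - a))"

end

theory Submission
  imports Defs
begin

text \<open>
  The set function \<open>\<nu>\<^sup>\<sharp>\<close> does not charge \<open>S\<^sub>\<mu> - X\<close>. Indeed, if \<open>a < - \<phi>'\<^sub>r(0)\<close>, some \<open>t > 0\<close> satisfies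
  \<open>\<phi>(t) < - a t\<close>; a point where the lower local dimension of \<open>\<mu>\<close> is below \<open>a\<close> is the center of
  arbitrarily small balls with \<open>\<mu>(B) > r\<^sup>a\<close>, hence \<open>\<nu>(B) \<le> r\<^sup>s \<mu>(B)\<^sup>t \<nu>(B)\<close> for \<open>s = - a t\<close>, and the
  Besicovitch property bounds \<open>\<nu>\<^sup>\<sharp>\<close> of these points by a packing sum that vanishes because
  \<open>s > \<phi>(t)\<close>. Negative \<open>t\<close> deals with the upper local dimension. Hence \<open>\<nu>\<^sup>\<sharp>(X) > 0\<close>, and both dimension
  bounds follow by comparing \<open>\<nu>(B)\<close> with \<open>r\<^sup>s\<close>.

  Convexity of \<open>\<phi>\<close> enters only through \<open>\<phi>(l t) \<le> l \<phi>(t)\<close>, which makes \<open>\<phi>(t) / t\<close> monotone on either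
  side of \<open>0\<close>, so that the one-sided derivatives exist. For \<open>B\<close> it requires covers of \<open>S\<^sub>\<mu>\<close> whose
  pieces have packing premeasure zero rather than merely a small sum; raising \<open>s\<close> slightly
  provides them.
\<close>

section \<open>Limits of monotone functions and sums with values in \<open>ennreal\<close>\<close>

text \<open>A value defined by \<open>Lim\<close> can be used only once convergence is known.
  Monotonicity supplies it, for packing premeasures and right derivatives; the antitone version
  below serves Hausdorff measures and left derivatives.\<close>

lemma mono_tendsto_INF_at_right:
  fixes f :: "real \<Rightarrow> 'b::{complete_linorder,linorder_topology}"
  assumes mono: "\<And>x y. a < x \<Longrightarrow> x \<le> y \<Longrightarrow> f x \<le> f y"
  shows "(f \<longlongrightarrow> (INF x\<in>{a<..}. f x)) (at_right a)"
proof (rule order_tendstoI)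
  fix c assume "c < (INF x\<in>{a<..}. f x)"
  then have "a < x \<Longrightarrow> c < f x" for x
    by (meson INF_lower greaterThan_iff less_le_trans)
  then show "\<forall>\<^sub>F x in at_right a. c < f x"
    by (auto intro: eventually_mono[OF eventually_at_right_less])
next
  fix c assume "(INF x\<in>{a<..}. f x) < c"
  then obtain y where "a < y" "f y < c"
    by (auto simp: INF_less_iff)
  then have "x \<in> {a<..<y} \<Longrightarrow> f x < c" for x
    using mono[of x y] by auto
  then show "\<forall>\<^sub>F x in at_right a. f x < c"
    using \<open>a < y\<close> by (auto simp: eventually_at_right_field)
qed

lemma antimono_tendsto_SUP_at_right:
  fixes f :: "real \<Rightarrow> 'b::{complete_linorder,linorder_topology}"
  assumes mono: "\<And>x y. a < x \<Longrightarrow> x \<le> y \<Longrightarrow> f y \<le> f x"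
  shows "(f \<longlongrightarrow> (SUP x\<in>{a<..}. f x)) (at_right a)"
proof (rule order_tendstoI)
  fix c assume "(SUP x\<in>{a<..}. f x) < c"
  then have "a < x \<Longrightarrow> f x < c" for x
    by (meson SUP_upper greaterThan_iff le_less_trans)
  then show "\<forall>\<^sub>F x in at_right a. f x < c"
    by (auto intro: eventually_mono[OF eventually_at_right_less])
next
  fix c assume "c < (SUP x\<in>{a<..}. f x)"
  then obtain y where "a < y" "c < f y"
    by (auto simp: less_SUP_iff)
  then have "x \<in> {a<..<y} \<Longrightarrow> c < f x" for x
    using mono[of x y] by auto
  then show "\<forall>\<^sub>F x in at_right a. c < f x"
    using \<open>a < y\<close> by (auto simp: eventually_at_right_field)
qed

lemma infsum_ennreal_eq_SUP:
  fixes w :: "'b \<Rightarrow> ennreal"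
  shows "infsum w S = (SUP F\<in>{F. finite F \<and> F \<subseteq> S}. sum w F)"
  by (rule nonneg_infsum_complete) simp

lemma sum_le_infsum_ennreal:
  fixes w :: "'b \<Rightarrow> ennreal"
  assumes "finite F" "F \<subseteq> S"
  shows "sum w F \<le> infsum w S"
  unfolding infsum_ennreal_eq_SUP by (rule SUP_upper) (use assms in auto)

lemma infsum_mono_ennreal:
  fixes v w :: "'b \<Rightarrow> ennreal"
  assumes "\<And>b. b \<in> S \<Longrightarrow> v b \<le> w b"
  shows "infsum v S \<le> infsum w S"
  by (intro infsum_mono nonneg_summable_on_complete assms) auto

text \<open>The \<open>A j\<close> may overlap, so each element of a finite subset is charged to one
  index \<open>i b\<close>, and the finite sum splits along the fibres of \<open>i\<close>.\<close>

lemma infsum_UN_le_suminf: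
  fixes w :: "'b \<Rightarrow> ennreal" and A :: "nat \<Rightarrow> 'b set"
  shows "infsum w (\<Union>j. A j) \<le> (\<Sum>j. infsum w (A j))"
  unfolding infsum_ennreal_eq_SUP[of w "\<Union>j. A j"]
proof (rule SUP_least)
  fix F assume "F \<in> {F. finite F \<and> F \<subseteq> (\<Union>j. A j)}"
  then have fin: "finite F" and sub: "F \<subseteq> (\<Union>j. A j)" by auto
  from sub have "\<forall>b\<in>F. \<exists>j. b \<in> A j" by auto
  then obtain i where i: "\<And>b. b \<in> F \<Longrightarrow> b \<in> A (i b)" by metis
  have "sum w F = (\<Sum>j\<in>i ` F. sum w {b \<in> F. i b = j})"
    using fin by (simp add: sum.group)
  also have "\<dots> \<le> (\<Sum>j\<in>i ` F. infsum w (A j))"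
    by (intro sum_mono sum_le_infsum_ennreal) (use fin i in force)+
  also have "\<dots> \<le> (\<Sum>j. infsum w (A j))"
    by (rule sum_le_suminf) (use fin in auto)
  finally show "sum w F \<le> (\<Sum>j. infsum w (A j))" .
qed

lemma infsum_cmult_le_ennreal:
  fixes v w :: "'b \<Rightarrow> ennreal"
  assumes "\<And>b. b \<in> S \<Longrightarrow> v b \<le> c * w b"
  shows "infsum v S \<le> c * infsum w S"
  unfolding infsum_ennreal_eq_SUP[of v]
proof (rule SUP_least)
  fix F assume "F \<in> {F. finite F \<and> F \<subseteq> S}"
  then have F: "finite F" "F \<subseteq> S" by auto
  have "sum v F \<le> (\<Sum>b\<in>F. c * w b)"
    by (intro sum_mono assms) (use F in auto)
  also have "\<dots> = c * sum w F"
    by (simp add: sum_distrib_left)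
  also have "\<dots> \<le> c * infsum w S"
    by (intro mult_left_mono sum_le_infsum_ennreal F) auto
  finally show "sum v F \<le> c * infsum w S" .
qed

lemma suminf_geometric_half_ennreal:
  assumes "0 \<le> e"
  shows "(\<Sum>j. ennreal (e * (1/2) ^ Suc j)) = ennreal e"
proof (rule suminf_ennreal_eq)
  show "(\<lambda>j. e * (1/2) ^ Suc j) sums e"
    using sums_mult[OF power_half_series, of e] by simp
qed (use assms in auto)

lemma ennreal_eq_0I:
  fixes x :: ennreal
  assumes "\<And>e::real. 0 < e \<Longrightarrow> x \<le> ennreal e"
  shows "x = 0"
  using assms by (metis add.left_neutral ennreal_le_epsilon le_zero_eq)

section \<open>Null sets of the outer measure \<open>sharp\<close>\<close>

lemma sharp_le:
  assumes "countable \<C>" "\<And>b. b \<in> \<C> \<Longrightarrow> 0 < snd b" "E \<subseteq> (\<Union>b\<in>\<C>. pball b)"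
  shows "sharp \<nu> E \<le> (\<Sum>\<^sub>\<infinity>b\<in>\<C>. ennreal (\<nu> (pball b)))"
  unfolding sharp_def by (rule INF_lower) (use assms in auto)

lemma sharp_empty: "sharp \<nu> {} = 0"
  using sharp_le[of "{}" "{}" \<nu>] by simp

lemma sharp_UN_null:
  fixes A :: "nat \<Rightarrow> 'a::metric_space set"
  assumes null: "\<And>j. sharp \<nu> (A j) = 0" and E: "E \<subseteq> (\<Union>j. A j)"
  shows "sharp \<nu> E = 0"
proof (rule ennreal_eq_0I)
  fix e :: real assume e: "0 < e"
  define good where "good j \<C> \<longleftrightarrow> countable \<C> \<and> (\<forall>b\<in>\<C>. 0 < snd b) \<and> A j \<subseteq> (\<Union>b\<in>\<C>. pball b) \<and>
      (\<Sum>\<^sub>\<infinity>b\<in>\<C>. ennreal (\<nu> (pball b))) < ennreal (e * (1/2) ^ Suc j)" for j \<C>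
  have "\<exists>\<C>. good j \<C>" for j
  proof -
    have "sharp \<nu> (A j) < ennreal (e * (1/2) ^ Suc j)"
      using e by (simp add: null)
    then show ?thesis
      unfolding sharp_def INF_less_iff Bex_def mem_Collect_eq good_def
      by (elim exE conjE) (intro exI conjI)
  qed
  then obtain \<C> where good: "\<And>j. good j (\<C> j)"
    by metis
  have \<C>: "countable (\<C> j)" "\<forall>b\<in>\<C> j. 0 < snd b" "A j \<subseteq> (\<Union>b\<in>\<C> j. pball b)"
      "(\<Sum>\<^sub>\<infinity>b\<in>\<C> j. ennreal (\<nu> (pball b))) < ennreal (e * (1/2) ^ Suc j)" for j
    using good[of j] unfolding good_def by blast+
  have "sharp \<nu> E \<le> (\<Sum>\<^sub>\<infinity>b\<in>(\<Union>j. \<C> j). ennreal (\<nu> (pball b)))"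
  proof (rule sharp_le)
    show "E \<subseteq> (\<Union>b\<in>(\<Union>j. \<C> j). pball b)"
    proof
      fix x assume "x \<in> E"
      then obtain j where "x \<in> A j" using E by blast
      then obtain b where "b \<in> \<C> j" "x \<in> pball b" using \<C>(3)[of j] by blast
      then show "x \<in> (\<Union>b\<in>(\<Union>j. \<C> j). pball b)" by blast
    qed
  qed (use \<C>(1,2) in auto)
  also have "\<dots> \<le> (\<Sum>j. \<Sum>\<^sub>\<infinity>b\<in>\<C> j. ennreal (\<nu> (pball b)))"
    by (rule infsum_UN_le_suminf)
  also have "\<dots> \<le> (\<Sum>j. ennreal (e * (1/2) ^ Suc j))"
    by (intro suminf_le less_imp_le \<C>) auto
  also have "\<dots> = ennreal e"
    using e by (intro suminf_geometric_half_ennreal) simp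
  finally show "sharp \<nu> E \<le> ennreal e" .
qed

lemma sharp_Un_null:
  assumes "sharp \<nu> A = 0" "sharp \<nu> B = 0" "E \<subseteq> A \<union> B"
  shows "sharp \<nu> E = 0"
  by (rule sharp_UN_null[where A = "\<lambda>j. if j = 0 then A else B"])
    (use assms in \<open>auto split: if_splits\<close>)

section \<open>Packing premeasures and their null sets\<close>

lemma packings_mono: "\<delta> \<le> \<delta>' \<Longrightarrow> A \<subseteq> A' \<Longrightarrow> packings \<delta> A \<subseteq> packings \<delta>' A'"
  unfolding packings_def by fastforce

lemma packing_pre_delta_mono:
  "\<delta> \<le> \<delta>' \<Longrightarrow> A \<subseteq> A' \<Longrightarrow> packing_pre_delta w \<delta> A \<le> packing_pre_delta w \<delta>' A'"
  unfolding packing_pre_delta_def by (intro SUP_subset_mono packings_mono) auto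

lemma infsum_le_packing_pre_delta:
  "P \<in> packings \<delta> A \<Longrightarrow> infsum w P \<le> packing_pre_delta w \<delta> A"
  unfolding packing_pre_delta_def by (rule SUP_upper)

text \<open>Shrinking \<delta> leaves fewer packings, so the \<open>Lim\<close> in
  \<open>packing_pre\<close> is a genuine limit, namely an infimum.\<close>

lemma packing_pre_delta_tendsto:
  "((\<lambda>\<delta>. packing_pre_delta w \<delta> A) \<longlongrightarrow> packing_pre w A) (at_right 0)"
proof -
  have "((\<lambda>\<delta>. packing_pre_delta w \<delta> A) \<longlongrightarrow> (INF \<delta>\<in>{0<..}. packing_pre_delta w \<delta> A)) (at_right 0)"
    by (intro mono_tendsto_INF_at_right packing_pre_delta_mono) auto
  then show ?thesis
    unfolding packing_pre_def by (simp add: tendsto_Lim)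
qed

lemma packing_pre_null_mono:
  assumes "packing_pre w A' = 0" "A \<subseteq> A'"
  shows "packing_pre w A = 0"
proof -
  have "packing_pre w A \<le> packing_pre w A'"
    by (rule tendsto_le[OF _ packing_pre_delta_tendsto packing_pre_delta_tendsto])
      (simp_all add: packing_pre_delta_mono assms)
  then show ?thesis using assms by simp
qed

lemma packing_meas_null_if_cover:
  fixes A :: "nat \<Rightarrow> 'a::metric_space set"
  assumes "E \<subseteq> (\<Union>j. A j)" "\<And>j. packing_pre w (A j) = 0"
  shows "packing_meas w E = 0"
proof -
  have "packing_meas w E \<le> (\<Sum>j. packing_pre w (A j))"
    unfolding packing_meas_def by (rule INF_lower) (use assms in auto)
  then show ?thesis using assms by simp
qed

text \<open>The infimum over covers need not be attained, but a cover with sum below 1 has pieces of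
  finite premeasure. That suffices, since a higher exponent makes such pieces null.\<close>

lemma packing_meas_null_cover_finite:
  assumes "packing_meas w E = 0"
  obtains A :: "nat \<Rightarrow> 'a::metric_space set" where "E \<subseteq> (\<Union>j. A j)" "\<forall>j. packing_pre w (A j) < \<infinity>"
proof -
  have "packing_meas w E < 1" by (simp add: assms)
  then obtain A where A: "E \<subseteq> (\<Union>j. A j)" "(\<Sum>j. packing_pre w (A j)) < 1"
    unfolding packing_meas_def INF_less_iff by blast
  have "packing_pre w (A j) < \<infinity>" for j
  proof -
    have "packing_pre w (A j) \<le> (\<Sum>j. packing_pre w (A j))"
      using sum_le_suminf[of "\<lambda>j. packing_pre w (A j)" "{j}"] by simp
    also note A(2)
    also have "(1::ennreal) < \<infinity>" by simp
    finally show ?thesis .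
  qed
  with A(1) show ?thesis by (intro that) auto
qed

text \<open>On a \<delta>-packing the extra factor \<open>r powr h\<close> is at most
  \<open>\<delta> powr h\<close>, which tends to 0, while the premeasures of \<open>w\<close> tend
  to a finite limit.\<close>

lemma packing_pre_null_if_higher_order:
  assumes h: "0 < h" and fin: "packing_pre w A < \<infinity>"
    and le: "\<And>b. 0 < snd b \<Longrightarrow> v b \<le> ennreal (snd b powr h) * w b"
  shows "packing_pre v A = 0"
proof -
  have bound: "packing_pre_delta v \<delta> A \<le> ennreal (\<delta> powr h) * packing_pre_delta w \<delta> A" for \<delta>
    unfolding packing_pre_delta_def[of v]
  proof (rule SUP_least)
    fix P assume P: "P \<in> packings \<delta> A"
    have "infsum v P \<le> ennreal (\<delta> powr h) * infsum w P"
    proof (rule infsum_cmult_le_ennreal)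
      fix b assume "b \<in> P"
      then have b: "0 < snd b" "snd b \<le> \<delta>" using P by (auto simp: packings_def)
      then have "v b \<le> ennreal (snd b powr h) * w b" using le by simp
      also have "\<dots> \<le> ennreal (\<delta> powr h) * w b"
        using b h by (intro mult_right_mono ennreal_leI powr_mono2) auto
      finally show "v b \<le> ennreal (\<delta> powr h) * w b" .
    qed
    also have "\<dots> \<le> ennreal (\<delta> powr h) * packing_pre_delta w \<delta> A"
      by (intro mult_left_mono infsum_le_packing_pre_delta P) auto
    finally show "infsum v P \<le> ennreal (\<delta> powr h) * packing_pre_delta w \<delta> A" .
  qed
  have "((\<lambda>\<delta>::real. \<delta> powr h) \<longlongrightarrow> 0 powr h) (at_right 0)"
    using h by (intro tendsto_powr2 tendsto_const tendsto_ident_at)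
      (auto simp: eventually_at_filter)
  then have "((\<lambda>\<delta>::real. ennreal (\<delta> powr h)) \<longlongrightarrow> ennreal 0) (at_right 0)"
    using h by (intro tendsto_ennrealI) simp
  then have "((\<lambda>\<delta>. ennreal (\<delta> powr h) * packing_pre_delta w \<delta> A) \<longlongrightarrow> ennreal 0 * packing_pre w A) (at_right 0)"
    by (intro tendsto_mult_ennreal packing_pre_delta_tendsto) (use fin in auto)
  then have "packing_pre v A \<le> ennreal 0 * packing_pre w A"
    by (rule tendsto_le[OF trivial_limit_at_right_real _ packing_pre_delta_tendsto])
      (simp add: bound)
  then show ?thesis by simp
qed

lemma packing_pre_null_if_le_add:
  assumes null: "packing_pre w A = 0" "packing_pre w' A = 0"
    and le: "\<And>b. 0 < snd b \<Longrightarrow> v b \<le> w b + w' b"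
  shows "packing_pre v A = 0"
proof -
  have bound: "packing_pre_delta v \<delta> A \<le> packing_pre_delta w \<delta> A + packing_pre_delta w' \<delta> A" for \<delta>
    unfolding packing_pre_delta_def[of v]
  proof (rule SUP_least)
    fix P assume P: "P \<in> packings \<delta> A"
    have "infsum v P \<le> infsum (\<lambda>b. w b + w' b) P"
      by (intro infsum_mono_ennreal le) (use P in \<open>auto simp: packings_def\<close>)
    also have "\<dots> = infsum w P + infsum w' P"
      by (intro infsum_add nonneg_summable_on_complete) auto
    also have "\<dots> \<le> packing_pre_delta w \<delta> A + packing_pre_delta w' \<delta> A"
      by (intro add_mono infsum_le_packing_pre_delta P)
    finally show "infsum v P \<le> packing_pre_delta w \<delta> A + packing_pre_delta w' \<delta> A" .
  qed
  have "packing_pre v A \<le> packing_pre w A + packing_pre w' A"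
    by (rule tendsto_le[OF _ tendsto_add[OF packing_pre_delta_tendsto packing_pre_delta_tendsto]
          packing_pre_delta_tendsto])
      (simp_all add: bound)
  then show ?thesis using null by simp
qed

section \<open>Null sets of \<open>sharp\<close> from packings and from Hausdorff covers\<close>

text \<open>The Besicovitch property extracts, from the small balls with
  \<open>\<nu>(B) \<le> w(B)\<close>, \<open>C\<close> disjoint families that together cover
  \<open>E\<close>. Each is a packing of \<open>E\<close>, so \<open>sharp \<nu> E\<close> is at
  most \<open>C\<close> times the premeasure at every scale.\<close>

lemma sharp_null_if_packing_pre_null:
  fixes \<nu> :: "'a::metric_space set \<Rightarrow> real"
  assumes bes: "besicovitch_property TYPE('a)"
    and null: "packing_pre w E = 0"
    and freq: "\<And>x. x \<in> E \<Longrightarrow> \<exists>\<^sub>F r in at_right 0. ennreal (\<nu> (ball x r)) \<le> w (x, r)"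
  shows "sharp \<nu> E = 0"
proof -
  obtain C :: nat where C: "\<forall>\<B> :: ('a \<times> real) set. (\<forall>b\<in>\<B>. 0 < snd b) \<and> bdd_above (snd ` \<B>) \<longrightarrow>
      (\<exists>F :: nat \<Rightarrow> ('a \<times> real) set.
        (\<forall>j\<in>{1..C}. F j \<subseteq> \<B> \<and> countable (F j) \<and> disjoint_balls (F j)) \<and>
        fst ` \<B> \<subseteq> (\<Union>j\<in>{1..C}. \<Union>b\<in>F j. pball b))"
    using bes unfolding besicovitch_property_def by (elim exE)
  have bound: "sharp \<nu> E \<le> of_nat C * packing_pre_delta w \<delta> E" if \<delta>: "0 < \<delta>" for \<delta>
  proof -
    \<comment> \<open>The cap \<delta> bounds the radii, as the Besicovitch property asks, and makes
      each disjoint family a \<delta>-packing.\<close>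
    define \<B> where "\<B> = {(x, r). x \<in> E \<and> 0 < r \<and> r \<le> \<delta> \<and> ennreal (\<nu> (ball x r)) \<le> w (x, r)}"
    have "E \<subseteq> fst ` \<B>"
    proof
      fix x assume x: "x \<in> E"
      have "\<forall>\<^sub>F r in at_right 0. 0 < r \<and> r \<le> \<delta>"
        unfolding eventually_at_right_field using \<delta> by (intro exI[of _ \<delta>]) auto
      with freq[OF x] have "\<exists>\<^sub>F r in at_right 0. (0 < r \<and> r \<le> \<delta>) \<and> ennreal (\<nu> (ball x r)) \<le> w (x, r)"
        by (rule frequently_eventually_conj)
      then obtain r where "0 < r" "r \<le> \<delta>" "ennreal (\<nu> (ball x r)) \<le> w (x, r)"
        using frequently_ex by blast
      then have "(x, r) \<in> \<B>" using x by (simp add: \<B>_def)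
      then show "x \<in> fst ` \<B>" by force
    qed
    have "(\<forall>b\<in>\<B>. 0 < snd b) \<and> bdd_above (snd ` \<B>)"
      by (auto simp: \<B>_def intro!: bdd_aboveI[of _ \<delta>])
    from C[rule_format, OF this] obtain F where
      F: "\<forall>j\<in>{1..C}. F j \<subseteq> \<B> \<and> countable (F j) \<and> disjoint_balls (F j)"
        "fst ` \<B> \<subseteq> (\<Union>j\<in>{1..C}. \<Union>b\<in>F j. pball b)"
      by (elim exE conjE)
    define G where "G j = (if j \<in> {1..C} then F j else {})" for j
    have G: "G j \<subseteq> \<B>" "countable (G j)" for j
      using F(1) by (auto simp: G_def)
    have "E \<subseteq> (\<Union>b\<in>(\<Union>j. G j). pball b)"
    proof
      fix x assume "x \<in> E"
      then obtain j b where "j \<in> {1..C}" "b \<in> F j" "x \<in> pball b"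
        using F(2) \<open>E \<subseteq> fst ` \<B>\<close> by blast
      then show "x \<in> (\<Union>b\<in>(\<Union>j. G j). pball b)"
        by (auto simp: G_def intro!: exI[of _ j] bexI[of _ b])
    qed
    moreover have G': "0 < snd b \<and> ennreal (\<nu> (pball b)) \<le> w b" if "b \<in> (\<Union>j. G j)" for b
      using that G(1) by (force simp: \<B>_def)
    ultimately have "sharp \<nu> E \<le> (\<Sum>\<^sub>\<infinity>b\<in>(\<Union>j. G j). ennreal (\<nu> (pball b)))"
      using G(2) by (intro sharp_le) auto
    also have "\<dots> \<le> (\<Sum>\<^sub>\<infinity>b\<in>(\<Union>j. G j). w b)"
      by (intro infsum_mono_ennreal) (use G' in blast)
    also have "\<dots> \<le> (\<Sum>j. infsum w (G j))"
      by (rule infsum_UN_le_suminf)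
    also have "\<dots> = (\<Sum>j\<in>{1..C}. infsum w (G j))"
      by (rule suminf_finite) (auto simp: G_def)
    also have "\<dots> \<le> (\<Sum>j\<in>{1..C}. packing_pre_delta w \<delta> E)"
    proof (intro sum_mono infsum_le_packing_pre_delta)
      fix j assume j: "j \<in> {1..C}"
      have "fst b \<in> E \<and> 0 < snd b \<and> snd b \<le> \<delta>" if "b \<in> F j" for b
        using that F(1) j by (force simp: \<B>_def)
      then show "G j \<in> packings \<delta> E"
        using F(1) j by (simp add: packings_def G_def)
    qed
    also have "\<dots> = of_nat C * packing_pre_delta w \<delta> E"
      by simp
    finally show ?thesis .
  qed
  have "((\<lambda>\<delta>. of_nat C * packing_pre_delta w \<delta> E) \<longlongrightarrow> of_nat C * packing_pre w E) (at_right 0)"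
    by (intro ennreal_tendsto_cmult packing_pre_delta_tendsto) (simp add: of_nat_less_top)
  then have "sharp \<nu> E \<le> of_nat C * packing_pre w E"
    by (rule tendsto_lowerbound) (auto intro: eventually_mono[OF eventually_at_right_less] bound)
  then show ?thesis by (simp add: null)
qed

lemma sharp_null_if_packing_cover_null:
  fixes \<nu> :: "'a::metric_space set \<Rightarrow> real" and A :: "nat \<Rightarrow> 'a set"
  assumes bes: "besicovitch_property TYPE('a)"
    and A: "E \<subseteq> (\<Union>j. A j)" "\<And>j. packing_pre w (A j) = 0"
    and freq: "\<And>x. x \<in> E \<Longrightarrow> \<exists>\<^sub>F r in at_right 0. ennreal (\<nu> (ball x r)) \<le> w (x, r)"
  shows "sharp \<nu> E = 0"
proof (rule sharp_UN_null[where A = "\<lambda>j. E \<inter> A j"])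
  show "sharp \<nu> (E \<inter> A j) = 0" for j
    by (rule sharp_null_if_packing_pre_null[OF bes packing_pre_null_mono[OF A(2)[of j]]])
      (use freq in auto)
  show "E \<subseteq> (\<Union>j. E \<inter> A j)" using A(1) by blast
qed

text \<open>Each covering set that meets \<open>E\<close> is enlarged to a ball centered at one of
  its points in \<open>E\<close>, with radius slightly above the diameter. There
  \<open>\<nu>(B) \<le> r powr s\<close>, so the Hausdorff sum controls
  \<open>sharp \<nu> E\<close>.\<close>

lemma sharp_null_if_hausdorff_null:
  fixes \<nu> :: "'a::metric_space set \<Rightarrow> real"
  assumes s: "0 \<le> s" and null: "hausdorff_meas s X = 0" and E: "E \<subseteq> X" and d: "0 < d"
    and bound: "\<And>x r. x \<in> E \<Longrightarrow> 0 < r \<Longrightarrow> r < d \<Longrightarrow> \<nu> (ball x r) \<le> r powr s"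
  shows "sharp \<nu> E = 0"
proof (rule ennreal_eq_0I)
  fix e :: real assume e: "0 < e"
  \<comment> \<open>The values grow as \<delta> shrinks, so a vanishing limit forces them to vanish
    at every scale. The scale \<open>d/2\<close> leaves room for radii between the diameter and
    \<open>d\<close>.\<close>
  have "((\<lambda>\<delta>. hausdorff_delta s \<delta> X) \<longlongrightarrow> (SUP \<delta>\<in>{0<..}. hausdorff_delta s \<delta> X)) (at_right 0)"
  proof (rule antimono_tendsto_SUP_at_right)
    fix \<delta> \<delta>' :: real assume "\<delta> \<le> \<delta>'"
    then show "hausdorff_delta s \<delta>' X \<le> hausdorff_delta s \<delta> X"
      unfolding hausdorff_delta_def by (intro INF_superset_mono) (auto intro: order_trans)
  qed
  then have "(SUP \<delta>\<in>{0<..}. hausdorff_delta s \<delta> X) = 0"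
    using null unfolding hausdorff_meas_def by (simp add: tendsto_Lim)
  then have "hausdorff_delta s (d/2) X = 0"
    using d SUP_upper[of "d/2" "{0<..}" "\<lambda>\<delta>. hausdorff_delta s \<delta> X"] by simp
  then have "hausdorff_delta s (d/2) X < ennreal (e/2)"
    using e by simp
  then obtain U where U: "X \<subseteq> (\<Union>i. U i)" "\<And>i::nat. bounded (U i)" "\<And>i. diameter (U i) \<le> d/2"
      "(\<Sum>i. diam_pow s (U i)) < ennreal (e/2)"
    unfolding hausdorff_delta_def INF_less_iff by blast
  \<comment> \<open>Balls are open, so the radius must exceed the diameter strictly; a share of
    \<open>e/2\<close> pays for the excess of \<open>r powr s\<close> over the diameter
    term.\<close>
  have ex: "\<exists>x r. x \<in> E \<and> x \<in> U i \<and> diameter (U i) < r \<and> r < d \<and>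
      ennreal (r powr s) \<le> diam_pow s (U i) + ennreal (e/2 * (1/2) ^ Suc i)"
    if ne: "U i \<inter> E \<noteq> {}" for i
  proof -
    define D where "D = diameter (U i)"
    define \<epsilon> where "\<epsilon> = e/2 * (1/2) ^ Suc i"
    have D: "0 \<le> D" "D < d"
      using diameter_ge_0[OF U(2)[of i]] U(3)[of i] d by (auto simp: D_def)
    have \<epsilon>: "0 < \<epsilon>" using e by (simp add: \<epsilon>_def)
    have ev: "\<forall>\<^sub>F r in at_right D. ennreal (r powr s) \<le> diam_pow s (U i) + ennreal \<epsilon>"
    proof (cases "s = 0")
      \<comment> \<open>For diameter 0 the map \<open>r powr 0\<close> is not continuous from the
        right, as \<open>0 powr 0 = 0\<close>; but \<open>diam_pow 0\<close> is 1 on every nonempty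
        set.\<close>
      case True
      have "ennreal (r powr s) \<le> diam_pow s (U i) + ennreal \<epsilon>" for r
      proof -
        have "ennreal (r powr s) \<le> 1" using True by (simp add: powr_def)
        also have "\<dots> \<le> diam_pow s (U i) + ennreal \<epsilon>"
          using ne True by (auto simp: diam_pow_def intro: add_increasing2)
        finally show ?thesis .
      qed
      then show ?thesis by simp
    next
      case False
      then have "((\<lambda>r. r powr s) \<longlongrightarrow> D powr s) (at_right D)"
        using s D by (intro tendsto_powr2 tendsto_const tendsto_ident_at)
          (auto simp: eventually_at_filter)
      then have "\<forall>\<^sub>F r in at_right D. r powr s < D powr s + \<epsilon>"
        by (rule order_tendstoD) (use \<epsilon> in simp)
      then show ?thesis
      proof eventually_elim
        case (elim r)
        have "diam_pow s (U i) = ennreal (D powr s)"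
          using ne False by (auto simp: diam_pow_def D_def)
        then show ?case using elim \<epsilon>
          by (simp add: ennreal_leI flip: ennreal_plus)
      qed
    qed
    have "\<forall>\<^sub>F r in at_right D. D < r \<and> r < d"
      unfolding eventually_at_right_field using D by (intro exI[of _ d]) auto
    with ev have "\<forall>\<^sub>F r in at_right D. D < r \<and> r < d \<and> ennreal (r powr s) \<le> diam_pow s (U i) + ennreal \<epsilon>"
      by eventually_elim auto
    then obtain r where "D < r \<and> r < d \<and> ennreal (r powr s) \<le> diam_pow s (U i) + ennreal \<epsilon>"
      using eventually_happens'[OF trivial_limit_at_right_real] by blast
    with ne show ?thesis unfolding D_def \<epsilon>_def by blast
  qed
  have "\<forall>i. \<exists>x r. U i \<inter> E \<noteq> {} \<longrightarrow> x \<in> E \<and> x \<in> U i \<and> diameter (U i) < r \<and> r < d \<and>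
      ennreal (r powr s) \<le> diam_pow s (U i) + ennreal (e/2 * (1/2) ^ Suc i)"
    using ex by blast
  then obtain x r where xr: "\<And>i. U i \<inter> E \<noteq> {} \<Longrightarrow> x i \<in> E \<and> x i \<in> U i \<and> diameter (U i) < r i \<and> r i < d \<and>
      ennreal (r i powr s) \<le> diam_pow s (U i) + ennreal (e/2 * (1/2) ^ Suc i)"
    by metis
  have r0: "0 < r i" if "U i \<inter> E \<noteq> {}" for i
    using xr[OF that] diameter_ge_0[OF U(2)[of i]] by linarith
  define G where "G i = (if U i \<inter> E \<noteq> {} then {(x i, r i)} else {})" for i
  have "E \<subseteq> (\<Union>b\<in>(\<Union>i. G i). pball b)"
  proof
    fix y assume y: "y \<in> E"
    then obtain i where i: "y \<in> U i" using U(1) E by blast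
    then have ne: "U i \<inter> E \<noteq> {}" using y by blast
    have "dist (x i) y \<le> diameter (U i)"
      using diameter_bounded_bound[OF U(2)] xr[OF ne] i by blast
    then have "y \<in> ball (x i) (r i)" using xr[OF ne] by simp
    then show "y \<in> (\<Union>b\<in>(\<Union>i. G i). pball b)"
      using ne by (auto simp: G_def intro!: exI[of _ i])
  qed
  then have "sharp \<nu> E \<le> (\<Sum>\<^sub>\<infinity>b\<in>(\<Union>i. G i). ennreal (\<nu> (pball b)))"
    by (intro sharp_le) (use r0 in \<open>force simp: G_def split: if_splits\<close>)+
  also have "\<dots> \<le> (\<Sum>i. \<Sum>\<^sub>\<infinity>b\<in>G i. ennreal (\<nu> (pball b)))"
    by (rule infsum_UN_le_suminf)
  also have "\<dots> \<le> (\<Sum>i. diam_pow s (U i) + ennreal (e/2 * (1/2) ^ Suc i))"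
  proof (rule suminf_le)
    fix i
    show "(\<Sum>\<^sub>\<infinity>b\<in>G i. ennreal (\<nu> (pball b))) \<le> diam_pow s (U i) + ennreal (e/2 * (1/2) ^ Suc i)"
    proof (cases "U i \<inter> E \<noteq> {}")
      case True
      have "ennreal (\<nu> (ball (x i) (r i))) \<le> ennreal (r i powr s)"
        using bound xr[OF True] r0[OF True] by (intro ennreal_leI) auto
      also have "\<dots> \<le> diam_pow s (U i) + ennreal (e/2 * (1/2) ^ Suc i)"
        using xr[OF True] by blast
      finally show ?thesis using True by (simp add: G_def)
    qed (simp add: G_def)
  qed auto
  also have "\<dots> = (\<Sum>i. diam_pow s (U i)) + (\<Sum>i. ennreal (e/2 * (1/2) ^ Suc i))"
    by (intro suminf_add[symmetric]) auto
  also have "\<dots> \<le> ennreal (e/2) + ennreal (e/2)"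
    using suminf_geometric_half_ennreal[of "e/2"] e less_imp_le[OF U(4)] by (intro add_mono)
      (simp_all only:)
  also have "\<dots> = ennreal e"
    using e by (simp flip: ennreal_plus)
  finally show "sharp \<nu> E \<le> ennreal e" .
qed

section \<open>Mixed weights and the convexity of \<open>tau_fun\<close> and
  \<open>B_fun\<close>\<close>

lemma mixed_weight_shift:
  assumes "0 < snd b"
  shows "mixed_weight \<mu> \<nu> q (s + h) b = ennreal (snd b powr h) * mixed_weight \<mu> \<nu> q s b"
  using assms by (simp add: mixed_weight_def powr_add mult_ac flip: ennreal_mult')

text \<open>Young's inequality, applied ball by ball, replaces Hoelder's.\<close>

lemma mixed_weight_interpolate:
  assumes \<mu>: "\<mu> \<in> ball_funs" and \<nu>: "\<nu> \<in> ball_funs" and b: "0 < snd b" and l: "0 < l" "l < 1"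
  shows "mixed_weight \<mu> \<nu> (l * t + (1 - l) * t', q) (l * s + (1 - l) * s') b
    \<le> mixed_weight \<mu> \<nu> (t, q) s b + mixed_weight \<mu> \<nu> (t', q) s' b"
proof (cases "\<mu> (pball b) * \<nu> (pball b) = 0")
  case False
  define r m n where "r = snd b" "m = \<mu> (pball b)" "n = \<nu> (pball b)"
  have "pball b \<in> balls" using b by (auto simp: balls_def)
  then have "0 \<le> m" "0 \<le> n" using \<mu> \<nu> by (auto simp: ball_funs_def r_m_n_def)
  then have pos: "0 < r" "0 < m" "0 < n" using False b by (auto simp: r_m_n_def)
  \<comment> \<open>These are the two endpoint weights; the interpolated weight is their geometric
    mean with exponents \<open>l\<close> and \<open>1 - l\<close>.\<close>
  define u v where "u = r powr s * m powr t * n powr q" "v = r powr s' * m powr t' * n powr q"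
  have uv: "0 < u" "0 < v" using pos by (auto simp: u_v_def)
  have "r powr (l * s + (1 - l) * s') * m powr (l * t + (1 - l) * t') * n powr q
      = u powr l * v powr (1 - l)"
    using pos by (simp add: u_v_def powr_def ln_mult exp_add[symmetric] algebra_simps)
  also have "\<dots> \<le> l * u + (1 - l) * v"
    using l uv by (intro Youngs_inequality_0) auto
  also have "\<dots> \<le> u + v"
    using l uv by (intro add_mono) (auto simp: mult_le_cancel_right1)
  finally show ?thesis
    using False uv by (simp add: mixed_weight_def u_v_def r_m_n_def flip: ennreal_plus)
qed (simp add: mixed_weight_def)

lemma packing_pre_mixed_interpolate:
  assumes "\<mu> \<in> ball_funs" "\<nu> \<in> ball_funs" "0 < l" "l < 1"
    and "packing_pre (mixed_weight \<mu> \<nu> (t, q) s) A = 0"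
      "packing_pre (mixed_weight \<mu> \<nu> (t', q) s') A = 0"
  shows "packing_pre (mixed_weight \<mu> \<nu> (l * t + (1 - l) * t', q) (l * s + (1 - l) * s')) A = 0"
  using assms by (intro packing_pre_null_if_le_add[OF assms(5,6)] mixed_weight_interpolate)

lemma packing_pre_mixed_null_mono:
  assumes "packing_pre (mixed_weight \<mu> \<nu> q s) A < \<infinity>" "s < s'"
  shows "packing_pre (mixed_weight \<mu> \<nu> q s') A = 0"
proof (rule packing_pre_null_if_higher_order[OF _ assms(1)])
  show "0 < s' - s" using assms by simp
  show "mixed_weight \<mu> \<nu> q s' b \<le> ennreal (snd b powr (s' - s)) * mixed_weight \<mu> \<nu> q s b"
    if "0 < snd b" for b
    using mixed_weight_shift[OF that, of \<mu> \<nu> q s "s' - s"] by simp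
qed

lemma tau_fun_lessD:
  assumes "tau_fun \<mu> \<nu> E q < ereal s"
  shows "packing_pre (mixed_weight \<mu> \<nu> q s) E = 0"
proof -
  obtain s' where "packing_pre (mixed_weight \<mu> \<nu> q s') E = 0" "s' < s"
    using assms by (auto simp: tau_fun_def INF_less_iff)
  then show ?thesis by (intro packing_pre_mixed_null_mono[of \<mu> \<nu> q s']) auto
qed

lemma B_fun_lessD:
  assumes "B_fun \<mu> \<nu> E q < ereal s"
  obtains A :: "nat \<Rightarrow> 'a::metric_space set" where "E \<subseteq> (\<Union>j. A j)"
      "\<forall>j. packing_pre (mixed_weight \<mu> \<nu> q s) (A j) = 0"
proof -
  obtain s' where s': "s' < s" and "packing_meas (mixed_weight \<mu> \<nu> q s') E = 0"
    using assms by (auto simp: B_fun_def INF_less_iff)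
  from this(2) obtain A :: "nat \<Rightarrow> _ set" where "E \<subseteq> (\<Union>j. A j)"
      "\<forall>j. packing_pre (mixed_weight \<mu> \<nu> q s') (A j) < \<infinity>"
    by (rule packing_meas_null_cover_finite)
  then show ?thesis
    using that[of A] s' packing_pre_mixed_null_mono by blast
qed

lemma B_fun_leI:
  fixes A :: "nat \<Rightarrow> 'a::metric_space set"
  assumes "E \<subseteq> (\<Union>j. A j)" "\<And>j. packing_pre (mixed_weight \<mu> \<nu> q s) (A j) = 0"
  shows "B_fun \<mu> \<nu> E q \<le> ereal s"
  unfolding B_fun_def using packing_meas_null_if_cover[OF assms] by (intro INF_lower) simp

text \<open>\<open>E\<close> covers itself. Through this inequality both choices of \<phi> are
  handled by estimates on \<open>B_fun\<close> alone.\<close>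

lemma B_fun_le_tau_fun: "B_fun \<mu> \<nu> E q \<le> tau_fun \<mu> \<nu> E q"
  unfolding tau_fun_def
proof (rule INF_greatest)
  fix s assume "s \<in> {s. packing_pre (mixed_weight \<mu> \<nu> q s) E = 0}"
  then show "B_fun \<mu> \<nu> E q \<le> ereal s"
    by (intro B_fun_leI[where A = "\<lambda>j. E"]) auto
qed

lemma tau_fun_interpolate:
  assumes "\<mu> \<in> ball_funs" "\<nu> \<in> ball_funs" "0 < l" "l < 1"
    and "tau_fun \<mu> \<nu> E (t, q) < ereal s" "tau_fun \<mu> \<nu> E (t', q) < ereal s'"
  shows "tau_fun \<mu> \<nu> E (l * t + (1 - l) * t', q) \<le> ereal (l * s + (1 - l) * s')"
  unfolding tau_fun_def
  using packing_pre_mixed_interpolate[OF assms(1-4) tau_fun_lessD[OF assms(5)] tau_fun_lessD[OF assms(6)]]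
  by (intro INF_lower) simp

text \<open>On the pieces \<open>A i \<inter> A' j\<close> of the common refinement both premeasures
  vanish at once, so interpolation applies piece by piece.\<close>

lemma B_fun_interpolate:
  assumes "\<mu> \<in> ball_funs" "\<nu> \<in> ball_funs" "0 < l" "l < 1"
    and "B_fun \<mu> \<nu> E (t, q) < ereal s" "B_fun \<mu> \<nu> E (t', q) < ereal s'"
  shows "B_fun \<mu> \<nu> E (l * t + (1 - l) * t', q) \<le> ereal (l * s + (1 - l) * s')"
proof -
  obtain A :: "nat \<Rightarrow> _ set" where A: "E \<subseteq> (\<Union>j. A j)"
      "\<forall>j. packing_pre (mixed_weight \<mu> \<nu> (t, q) s) (A j) = 0"
    by (rule B_fun_lessD[OF assms(5)])
  obtain A' :: "nat \<Rightarrow> _ set" where A': "E \<subseteq> (\<Union>j. A' j)"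
      "\<forall>j. packing_pre (mixed_weight \<mu> \<nu> (t', q) s') (A' j) = 0"
    by (rule B_fun_lessD[OF assms(6)])
  define D where "D n = (case prod_decode n of (i, j) \<Rightarrow> A i \<inter> A' j)" for n
  show ?thesis
  proof (rule B_fun_leI)
    show "E \<subseteq> (\<Union>n. D n)"
    proof
      fix x assume "x \<in> E"
      then obtain i j where "x \<in> A i" "x \<in> A' j" using A(1) A'(1) by blast
      then have "x \<in> D (prod_encode (i, j))" by (simp add: D_def)
      then show "x \<in> (\<Union>n. D n)" by blast
    qed
    show "packing_pre (mixed_weight \<mu> \<nu> (l * t + (1 - l) * t', q) (l * s + (1 - l) * s')) (D n) = 0" for n
    proof -
      obtain i j where "prod_decode n = (i, j)" by (cases "prod_decode n")
      then have D: "D n = A i \<inter> A' j" by (simp add: D_def)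
      show ?thesis
        unfolding D using assms(1-4)
        by (intro packing_pre_mixed_interpolate packing_pre_null_mono[OF A(2)[rule_format, of i]]
            packing_pre_null_mono[OF A'(2)[rule_format, of j]]) auto
    qed
  qed
qed

section \<open>One-sided derivatives at 0\<close>

text \<open>Interpolation takes place between \<open>t\<close> and 0. A real number above
  \<open>l * \<phi> t\<close> leaves room for strict upper bounds at both endpoints, even if
  \<open>\<phi> t\<close> is infinite below.\<close>

lemma ereal_scaled_le_if_interpolate:
  fixes \<phi> :: "real \<Rightarrow> ereal"
  assumes int: "\<And>s s'. \<phi> t < ereal s \<Longrightarrow> \<phi> 0 < ereal s' \<Longrightarrow> \<phi> (l * t) \<le> ereal (l * s + (1 - l) * s')"
    and 0: "\<phi> 0 = 0" and l: "0 < l" "l < 1"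
  shows "\<phi> (l * t) \<le> ereal l * \<phi> t"
proof (rule dense_ge)
  fix y assume y: "ereal l * \<phi> t < y"
  show "\<phi> (l * t) \<le> y"
  proof (cases y)
    case (real y')
    have "\<phi> t < ereal (y' / l)"
      using y l real by (cases "\<phi> t") (auto simp: field_simps)
    then obtain s where s: "\<phi> t < ereal s" "s < y' / l"
      using ereal_dense2 by (metis ereal_less(1) less_ereal.simps(1))
    \<comment> \<open>This solves \<open>l * s + (1 - l) * s' = y'\<close>; as
      \<open>l * s < y'\<close>, it is positive, which is the bound required at 0.\<close>
    define s' where "s' = (y' - l * s) / (1 - l)"
    have "0 < s'" using s l by (simp add: s'_def field_simps)
    then have "\<phi> (l * t) \<le> ereal (l * s + (1 - l) * s')"
      using s 0 by (intro int) auto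
    also have "l * s + (1 - l) * s' = y'"
      using l by (simp add: s'_def)
    finally show ?thesis using real by simp
  next
    case MInf
    then show ?thesis using y by simp
  qed simp
qed

locale star_convex_ereal =
  fixes \<phi> :: "real \<Rightarrow> ereal"
  assumes zero: "\<phi> 0 = 0"
    and scaled_le: "\<And>l t. 0 < l \<Longrightarrow> l < 1 \<Longrightarrow> \<phi> (l * t) \<le> ereal l * \<phi> t"
begin

lemma quotient_mono_pos:
  assumes "0 < t" "t \<le> u"
  shows "\<phi> t / ereal t \<le> \<phi> u / ereal u"
proof (cases "t = u")
  case False
  then have "\<phi> ((t/u) * u) \<le> ereal (t/u) * \<phi> u"
    using assms by (intro scaled_le) auto
  then have "\<phi> t \<le> ereal (t/u) * \<phi> u" using assms by simp
  then show ?thesis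
    using assms by (cases "\<phi> t"; cases "\<phi> u") (auto simp: field_simps split: if_splits)
qed simp

lemma quotient_mono_neg:
  assumes "t \<le> u" "u < 0"
  shows "\<phi> t / ereal t \<le> \<phi> u / ereal u"
proof (cases "t = u")
  case False
  then have "\<phi> ((u/t) * t) \<le> ereal (u/t) * \<phi> t"
    using assms by (intro scaled_le) (auto simp: field_simps)
  then have "\<phi> u \<le> ereal (u/t) * \<phi> t" using assms by simp
  then show ?thesis
    using assms by (cases "\<phi> t"; cases "\<phi> u") (auto simp: field_simps split: if_splits)
qed simp

text \<open>Monotone quotients make the right derivative an infimum, so a strict upper bound already
  holds for one secant from 0.\<close>

lemma right_deriv_lessD:
  assumes "right_deriv \<phi> 0 < ereal c"
  shows "\<exists>t>0. \<phi> t < ereal (c * t)"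
proof -
  have "((\<lambda>t. \<phi> t / ereal t) \<longlongrightarrow> (INF t\<in>{0<..}. \<phi> t / ereal t)) (at_right 0)"
    by (intro mono_tendsto_INF_at_right quotient_mono_pos)
  then have "right_deriv \<phi> 0 = (INF t\<in>{0<..}. \<phi> t / ereal t)"
    unfolding right_deriv_def by (simp add: zero tendsto_Lim)
  then obtain t where "0 < t" "\<phi> t / ereal t < ereal c"
    using assms by (auto simp: INF_less_iff)
  then show ?thesis
    by (intro exI[of _ t]) (cases "\<phi> t"; auto simp: field_simps)
qed

lemma left_deriv_greaterD:
  assumes "ereal c < left_deriv \<phi> 0"
  shows "\<exists>t<0. \<phi> t < ereal (c * t)"
proof -
  \<comment> \<open>Reflection moves the left limit to the right of 0, where the quotient is
    antitone in \<open>t\<close> and its limit a supremum.\<close>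
  have "((\<lambda>t. \<phi> (-t) / ereal (-t)) \<longlongrightarrow> (SUP t\<in>{0<..}. \<phi> (-t) / ereal (-t))) (at_right 0)"
    by (intro antimono_tendsto_SUP_at_right quotient_mono_neg) auto
  then have "((\<lambda>t. \<phi> t / ereal t) \<longlongrightarrow> (SUP t\<in>{0<..}. \<phi> (-t) / ereal (-t))) (at_left 0)"
    by (simp add: filterlim_at_left_to_right)
  then have "left_deriv \<phi> 0 = (SUP t\<in>{0<..}. \<phi> (-t) / ereal (-t))"
    unfolding left_deriv_def by (simp add: zero tendsto_Lim)
  then obtain t where "0 < t" "ereal c < \<phi> (-t) / ereal (-t)"
    using assms by (auto simp: less_SUP_iff)
  then show ?thesis
    by (intro exI[of _ "-t"]) (cases "\<phi> (-t)"; auto simp: field_simps)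
qed

end

section \<open>Local dimensions in terms of powers of the radius\<close>

lemma supp_pos:
  assumes "\<mu> \<in> ball_funs" "x \<in> supp \<mu>" "0 < r"
  shows "0 < \<mu> (ball x r)"
proof -
  have "ball x r \<in> balls" using assms by (auto simp: balls_def)
  moreover have "x \<in> ball x r" using assms by simp
  ultimately have "\<mu> (ball x r) \<noteq> 0" "0 \<le> \<mu> (ball x r)"
    using assms unfolding supp_def ball_funs_def by blast+
  then show ?thesis by simp
qed

lemma eventually_at_right_0_small: "\<forall>\<^sub>F r::real in at_right 0. 0 < r \<and> r < 1"
  unfolding eventually_at_right_field by (intro exI[of _ 1]) auto

text \<open>\<open>ln r\<close> is negative for \<open>r < 1\<close>, so a small quotient means a
  large \<open>m\<close>, and conversely.\<close>

lemma elog_quotient_less_iff: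
  assumes "0 < m" "0 < r" "r < 1"
  shows "elog m / ereal (ln r) < ereal a \<longleftrightarrow> r powr a < m"
    and "ereal a < elog m / ereal (ln r) \<longleftrightarrow> m < r powr a"
proof -
  have "ln r < 0" using assms by simp
  moreover have "r powr a = exp (a * ln r)" "m = exp (ln m)"
    using assms by (simp_all add: powr_def)
  then have "r powr a < m \<longleftrightarrow> a * ln r < ln m" "m < r powr a \<longleftrightarrow> ln m < a * ln r"
    by (metis exp_less_cancel_iff)+
  ultimately show "elog m / ereal (ln r) < ereal a \<longleftrightarrow> r powr a < m"
    "ereal a < elog m / ereal (ln r) \<longleftrightarrow> m < r powr a"
    using assms by (auto simp: elog_def field_simps)
qed

text \<open>Unlike \<mu> around points of its support, \<nu> may vanish on a ball. Then
  \<open>elog\<close> makes the quotient infinite and the power bound is trivial.\<close>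

lemma elog_quotient_greaterD:
  assumes "0 \<le> m" "0 < r" "r < 1" "ereal a < elog m / ereal (ln r)"
  shows "m \<le> r powr a"
  using assms elog_quotient_less_iff(2)[of m r a] by (cases "m = 0") auto

lemma frequently_lower_local_dim_less:
  assumes "\<mu> \<in> ball_funs" "x \<in> supp \<mu>" "lower_local_dim \<mu> x < ereal a"
  shows "\<exists>\<^sub>F r in at_right 0. 0 < r \<and> r powr a < \<mu> (ball x r)"
proof -
  have "\<exists>\<^sub>F r in at_right 0. elog (\<mu> (ball x r)) / ereal (ln r) < ereal a"
    using assms(3) Liminf_bounded[of "ereal a" "\<lambda>r. elog (\<mu> (ball x r)) / ereal (ln r)" "at_right 0"]
    by (auto simp: lower_local_dim_def frequently_def not_less not_le[symmetric])
  from frequently_eventually_conj[OF this eventually_at_right_0_small] show ?thesis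
    by (rule frequently_elim1) (use elog_quotient_less_iff(1) supp_pos[OF assms(1,2)] in auto)
qed

text \<open>The conclusion keeps the quotient because it serves both \<mu>, where a strict power
  bound follows, and \<nu>, which may vanish.\<close>

lemma frequently_upper_local_dim_greater:
  assumes "ereal a < upper_local_dim \<mu> x"
  shows "\<exists>\<^sub>F r in at_right 0. (0 < r \<and> r < 1) \<and> ereal a < elog (\<mu> (ball x r)) / ereal (ln r)"
proof -
  have "\<exists>\<^sub>F r in at_right 0. ereal a < elog (\<mu> (ball x r)) / ereal (ln r)"
    using assms Limsup_bounded[of "\<lambda>r. elog (\<mu> (ball x r)) / ereal (ln r)" "ereal a" "at_right 0"]
    by (auto simp: upper_local_dim_def frequently_def not_less not_le[symmetric])
  from frequently_eventually_conj[OF this eventually_at_right_0_small] show ?thesis .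
qed

lemma eventually_lower_local_dim_greater:
  assumes "\<nu> \<in> ball_funs" "ereal s < lower_local_dim \<nu> x"
  shows "\<forall>\<^sub>F r in at_right 0. \<nu> (ball x r) \<le> r powr s"
proof -
  have "\<forall>\<^sub>F r in at_right 0. ereal s < elog (\<nu> (ball x r)) / ereal (ln r)"
    using assms(2) unfolding lower_local_dim_def by (rule less_LiminfD)
  with eventually_at_right_0_small show ?thesis
  proof eventually_elim
    case (elim r)
    then have "ball x r \<in> balls" by (auto simp: balls_def)
    then show ?case
      using assms(1) elim by (intro elog_quotient_greaterD) (auto simp: ball_funs_def)
  qed
qed

section \<open>Points whose local dimension leaves the prescribed range\<close>

text \<open>The factor \<open>r powr s * \<mu>(B) powr t\<close> is at least 1 on the selected
  balls, so the mixed weight dominates \<open>\<nu>(B)\<close> there.\<close>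

lemma sharp_null_if_B_fun_less:
  fixes \<mu> \<nu> :: "'a::metric_space set \<Rightarrow> real"
  assumes bes: "besicovitch_property TYPE('a)" and \<mu>: "\<mu> \<in> ball_funs" and \<nu>: "\<nu> \<in> ball_funs"
    and B: "B_fun \<mu> \<nu> (supp \<mu>) (t, 1) < ereal s" and E: "E \<subseteq> supp \<mu>"
    and freq: "\<And>x. x \<in> E \<Longrightarrow> \<exists>\<^sub>F r in at_right 0. 0 < r \<and> 1 \<le> r powr s * \<mu> (ball x r) powr t"
  shows "sharp \<nu> E = 0"
proof -
  obtain A :: "nat \<Rightarrow> _ set" where A: "supp \<mu> \<subseteq> (\<Union>j. A j)"
      "\<forall>j. packing_pre (mixed_weight \<mu> \<nu> (t, 1) s) (A j) = 0"
    by (rule B_fun_lessD[OF B])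
  show ?thesis
  proof (rule sharp_null_if_packing_cover_null[OF bes _ A(2)[rule_format]])
    show "E \<subseteq> (\<Union>j. A j)" using E A(1) by simp
    fix x assume x: "x \<in> E"
    from freq[OF x] show "\<exists>\<^sub>F r in at_right 0. ennreal (\<nu> (ball x r)) \<le> mixed_weight \<mu> \<nu> (t, 1) s (x, r)"
    proof (rule frequently_elim1)
      fix r assume r: "0 < r \<and> 1 \<le> r powr s * \<mu> (ball x r) powr t"
      have \<mu>0: "0 < \<mu> (ball x r)" using supp_pos[OF \<mu>] x E r by blast
      have "ball x r \<in> balls" using r by (auto simp: balls_def)
      then have \<nu>0: "0 \<le> \<nu> (ball x r)" using \<nu> by (simp add: ball_funs_def)
      then have "\<nu> (ball x r) \<le> r powr s * \<mu> (ball x r) powr t * \<nu> (ball x r)"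
        using mult_right_mono[of 1 "r powr s * \<mu> (ball x r) powr t" "\<nu> (ball x r)"] r by simp
      \<comment> \<open>If \<nu> vanishes on the ball, the mixed weight is 0 by convention and both
        sides agree.\<close>
      then show "ennreal (\<nu> (ball x r)) \<le> mixed_weight \<mu> \<nu> (t, 1) s (x, r)"
        using \<mu>0 \<nu>0 by (auto simp: mixed_weight_def intro: ennreal_leI)
    qed
  qed
qed

text \<open>For \<open>s = - a * t\<close> the criterion asks for
  \<open>r powr (a * t) \<le> \<mu>(B) powr t\<close>, which is \<open>r powr a < \<mu>(B)\<close>
  raised to a positive power.\<close>

lemma sharp_null_lower_local_dim_less:
  fixes \<mu> \<nu> :: "'a::metric_space set \<Rightarrow> real"
  assumes "besicovitch_property TYPE('a)" "\<mu> \<in> ball_funs" "\<nu> \<in> ball_funs"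
    and "B_fun \<mu> \<nu> (supp \<mu>) (t, 1) < ereal (- a * t)" and t: "0 < t"
  shows "sharp \<nu> {x \<in> supp \<mu>. lower_local_dim \<mu> x < ereal a} = 0"
proof (rule sharp_null_if_B_fun_less[OF assms(1-4)])
  fix x assume "x \<in> {x \<in> supp \<mu>. lower_local_dim \<mu> x < ereal a}"
  then have "\<exists>\<^sub>F r in at_right 0. 0 < r \<and> r powr a < \<mu> (ball x r)"
    using frequently_lower_local_dim_less[OF assms(2)] by simp
  then show "\<exists>\<^sub>F r in at_right 0. 0 < r \<and> 1 \<le> r powr (- a * t) * \<mu> (ball x r) powr t"
  proof (rule frequently_elim1)
    fix r assume r: "0 < r \<and> r powr a < \<mu> (ball x r)"
    then have "(r powr a) powr t \<le> \<mu> (ball x r) powr t"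
      using t by (intro powr_mono2) auto
    then show "0 < r \<and> 1 \<le> r powr (- a * t) * \<mu> (ball x r) powr t"
      using r by (simp add: powr_powr powr_minus field_simps)
  qed
qed auto

text \<open>A negative power reverses inequalities, so the balls controlled are now those with
  \<open>\<mu>(B) < r powr a\<close>.\<close>

lemma sharp_null_upper_local_dim_greater:
  fixes \<mu> \<nu> :: "'a::metric_space set \<Rightarrow> real"
  assumes "besicovitch_property TYPE('a)" "\<mu> \<in> ball_funs" "\<nu> \<in> ball_funs"
    and "B_fun \<mu> \<nu> (supp \<mu>) (t, 1) < ereal (- a * t)" and t: "t < 0"
  shows "sharp \<nu> {x \<in> supp \<mu>. ereal a < upper_local_dim \<mu> x} = 0"
proof (rule sharp_null_if_B_fun_less[OF assms(1-4)])
  fix x assume x: "x \<in> {x \<in> supp \<mu>. ereal a < upper_local_dim \<mu> x}"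
  then have "\<exists>\<^sub>F r in at_right 0. (0 < r \<and> r < 1) \<and> ereal a < elog (\<mu> (ball x r)) / ereal (ln r)"
    using frequently_upper_local_dim_greater by blast
  then show "\<exists>\<^sub>F r in at_right 0. 0 < r \<and> 1 \<le> r powr (- a * t) * \<mu> (ball x r) powr t"
  proof (rule frequently_elim1)
    fix r assume r: "(0 < r \<and> r < 1) \<and> ereal a < elog (\<mu> (ball x r)) / ereal (ln r)"
    have m: "0 < \<mu> (ball x r)" using supp_pos[OF assms(2)] x r by blast
    then have "\<mu> (ball x r) < r powr a" using elog_quotient_less_iff(2) r by blast
    then have "(r powr a) powr t \<le> \<mu> (ball x r) powr t"
      using t m by (intro powr_mono2') auto
    then show "0 < r \<and> 1 \<le> r powr (- a * t) * \<mu> (ball x r) powr t"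
      using r by (simp add: powr_powr powr_minus field_simps)
  qed
qed auto

text \<open>Rational thresholds express a strict inequality as a countable union.\<close>

lemma sharp_null_UN_rat:
  assumes "\<And>q::rat. P q \<Longrightarrow> sharp \<nu> (A q) = 0"
  shows "sharp \<nu> (\<Union>q\<in>Collect P. A q) = 0"
proof (rule sharp_UN_null)
  show "sharp \<nu> (if P (from_nat n) then A (from_nat n) else {}) = 0" for n
    using assms by (simp add: sharp_empty)
  show "(\<Union>q\<in>Collect P. A q) \<subseteq> (\<Union>n. if P (from_nat n) then A (from_nat n) else {})"
  proof
    fix x assume "x \<in> (\<Union>q\<in>Collect P. A q)"
    then obtain q where "P q" "x \<in> A q" by blast
    then show "x \<in> (\<Union>n. if P (from_nat n) then A (from_nat n) else {})"
      by (intro UN_I[of "to_nat q"]) auto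
  qed
qed

section \<open>Dimension bounds for sets of positive \<open>sharp\<close>\<close>

text \<open>Below the infimum of the lower local dimensions, \<open>\<nu>(B) \<le> r powr s\<close>
  holds at each point for all small radii, so a vanishing Hausdorff measure would make
  \<open>X\<close> null.\<close>

lemma hausdorff_dim_ge_INF_lower_local_dim:
  fixes \<nu> :: "'a::metric_space set \<Rightarrow> real"
  assumes \<nu>: "\<nu> \<in> ball_funs" and pos: "sharp \<nu> X \<noteq> 0"
  shows "(INF x\<in>X. lower_local_dim \<nu> x) \<le> hausdorff_dim X"
  unfolding hausdorff_dim_def
proof (rule INF_greatest, rule ccontr)
  fix s :: real assume s: "s \<in> {s. 0 \<le> s \<and> hausdorff_meas s X = 0}"
    and "\<not> (INF x\<in>X. lower_local_dim \<nu> x) \<le> ereal s"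
  then have dim: "ereal s < lower_local_dim \<nu> x" if "x \<in> X" for x
    using that by (meson INF_lower less_le_trans not_le)
  \<comment> \<open>The range of good radii depends on the point; it is uniform on each of these
    countably many pieces.\<close>
  define E where "E n = {x \<in> X. \<forall>r. 0 < r \<and> r < 1 / real (Suc n) \<longrightarrow> \<nu> (ball x r) \<le> r powr s}" for n
  have "sharp \<nu> X = 0"
  proof (rule sharp_UN_null)
    show "sharp \<nu> (E n) = 0" for n
      by (rule sharp_null_if_hausdorff_null[of s X _ "1 / real (Suc n)"])
      (use s in \<open>auto simp: E_def\<close>)
    show "X \<subseteq> (\<Union>n. E n)"
    proof
      fix x assume x: "x \<in> X"
      from eventually_lower_local_dim_greater[OF \<nu> dim[OF x]] obtain d
        where d: "0 < d" "\<And>r. 0 < r \<Longrightarrow> r < d \<Longrightarrow> \<nu> (ball x r) \<le> r powr s"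
        by (auto simp: eventually_at_right_field)
      obtain n where "1 / real (Suc n) < d"
        using d(1) nat_approx_posE by blast
      then have "x \<in> E n" using x d(2) by (auto simp: E_def)
      then show "x \<in> (\<Union>n. E n)" by blast
    qed
  qed
  with pos show False by simp
qed

text \<open>An upper local dimension bounds \<nu> only along some radii tending to 0, which is
  exactly what the Besicovitch argument uses.\<close>

lemma packing_dim_ge_INF_upper_local_dim:
  fixes \<nu> :: "'a::metric_space set \<Rightarrow> real"
  assumes bes: "besicovitch_property TYPE('a)" and \<nu>: "\<nu> \<in> ball_funs" and pos: "sharp \<nu> X \<noteq> 0"
  shows "(INF x\<in>X. upper_local_dim \<nu> x) \<le> packing_dim X"
  unfolding packing_dim_def
proof (rule INF_greatest, rule ccontr)
  fix s :: real assume s: "s \<in> {s. 0 \<le> s \<and> packing_meas (\<lambda>b. ennreal (snd b powr s)) X = 0}"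
    and "\<not> (INF x\<in>X. upper_local_dim \<nu> x) \<le> ereal s"
  then have "ereal s < (INF x\<in>X. upper_local_dim \<nu> x)"
    by (simp add: not_le)
  \<comment> \<open>The gap between \<open>s\<close> and \<open>s'\<close> turns finite premeasures
    into null ones, while \<open>s'\<close> stays below all upper local dimensions.\<close>
  from ereal_dense2[OF this] obtain s'
    where s': "ereal s < ereal s'" "ereal s' < (INF x\<in>X. upper_local_dim \<nu> x)"
    by blast
  then have dim: "ereal s' < upper_local_dim \<nu> x" if "x \<in> X" for x
    using that by (meson INF_lower less_le_trans)
  from s have "packing_meas (\<lambda>b. ennreal (snd b powr s)) X = 0"
    by simp
  then obtain A :: "nat \<Rightarrow> _ set" where A: "X \<subseteq> (\<Union>j. A j)"
      "\<forall>j. packing_pre (\<lambda>b. ennreal (snd b powr s)) (A j) < \<infinity>"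
    by (rule packing_meas_null_cover_finite)
  have null: "packing_pre (\<lambda>b. ennreal (snd b powr s')) (A j) = 0" for j
  proof (rule packing_pre_null_if_higher_order[OF _ A(2)[rule_format]])
    show "0 < s' - s" using s' by simp
    show "ennreal (snd b powr s') \<le> ennreal (snd b powr (s' - s)) * ennreal (snd b powr s)"
      for b :: "'a \<times> real"
      by (simp flip: ennreal_mult' powr_add)
  qed
  have "sharp \<nu> X = 0"
  proof (rule sharp_null_if_packing_cover_null[OF bes A(1) null])
    fix x assume "x \<in> X"
    from frequently_upper_local_dim_greater[OF dim[OF this]]
    show "\<exists>\<^sub>F r in at_right 0. ennreal (\<nu> (ball x r)) \<le> ennreal (snd (x, r) powr s')"
    proof (rule frequently_elim1)
      fix r assume r: "(0 < r \<and> r < 1) \<and> ereal s' < elog (\<nu> (ball x r)) / ereal (ln r)"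
      then have "ball x r \<in> balls" by (auto simp: balls_def)
      then show "ennreal (\<nu> (ball x r)) \<le> ennreal (snd (x, r) powr s')"
        using \<nu> r by (simp, intro ennreal_leI elog_quotient_greaterD) (auto simp: ball_funs_def)
    qed
  qed
  with pos show False by simp
qed

section \<open>Positivity of \<open>sharp \<nu>\<close> on the level set, and the two bounds\<close>

theorem corollary5:
  fixes \<mu> \<nu> :: "'a::metric_space set \<Rightarrow> real"
    and \<phi> :: "real \<Rightarrow> ereal"
    and X :: "'a set"
  assumes "besicovitch_property TYPE('a)"
    and "\<mu> \<in> ball_funs_star"
    and "\<nu> \<in> ball_funs"
    and "(\<forall>t. \<phi> t = B_fun \<mu> \<nu> (supp \<mu>) (t, 1)) \<or> (\<forall>t. \<phi> t = tau_fun \<mu> \<nu> (supp \<mu>) (t, 1))"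
    and "\<phi> 0 = 0"
    and "sharp \<nu> (supp \<mu>) > 0"
    and "X = level_set \<mu> (- right_deriv \<phi> 0) (- left_deriv \<phi> 0)"
  shows "hausdorff_dim X \<ge> (INF x\<in>X. lower_local_dim \<nu> x)
       \<and> packing_dim X \<ge> (INF x\<in>X. upper_local_dim \<nu> x)"
proof -
  have \<mu>: "\<mu> \<in> ball_funs" using assms(2) by (simp add: ball_funs_star_def)
  \<comment> \<open>Whichever function \<phi> is, an upper bound on it passes to
    \<open>B_fun\<close>.\<close>
  have B_le: "B_fun \<mu> \<nu> (supp \<mu>) (t, 1) \<le> \<phi> t" for t
    using assms(4) B_fun_le_tau_fun[of \<mu> \<nu> "supp \<mu>" "(t, 1)"] by auto
  interpret star_convex_ereal \<phi>
  proof
    show "\<phi> 0 = 0" by fact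
    fix l t :: real assume l: "0 < l" "l < 1"
    show "\<phi> (l * t) \<le> ereal l * \<phi> t"
    proof (rule ereal_scaled_le_if_interpolate[of \<phi> t l, OF _ \<open>\<phi> 0 = 0\<close> l])
      fix s s' assume "\<phi> t < ereal s" "\<phi> 0 < ereal s'"
      with assms(4) show "\<phi> (l * t) \<le> ereal (l * s + (1 - l) * s')"
        using B_fun_interpolate[OF \<mu> assms(3) l, of "supp \<mu>" t 1 s 0 s']
          tau_fun_interpolate[OF \<mu> assms(3) l, of "supp \<mu>" t 1 s 0 s'] by auto
    qed
  qed
  define lo where "lo a \<longleftrightarrow> ereal a < - right_deriv \<phi> 0" for a
  define hi where "hi a \<longleftrightarrow> - left_deriv \<phi> 0 < ereal a" for a
  have lo: "sharp \<nu> {x \<in> supp \<mu>. lower_local_dim \<mu> x < ereal a} = 0" if "lo a" for a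
  proof -
    \<comment> \<open>A secant from 0 of slope below \<open>- a\<close> puts \<open>\<phi> t\<close>
      below \<open>- a * t\<close>, the exponent that the null-set lemma uses.\<close>
    have "right_deriv \<phi> 0 < ereal (- a)"
      using that by (simp add: lo_def ereal_less_uminus_reorder flip: uminus_ereal.simps)
    then obtain t where "0 < t" "\<phi> t < ereal (- a * t)" using right_deriv_lessD by blast
    then show ?thesis
      using sharp_null_lower_local_dim_less[OF assms(1) \<mu> assms(3)] B_le le_less_trans by blast
  qed
  have hi: "sharp \<nu> {x \<in> supp \<mu>. ereal a < upper_local_dim \<mu> x} = 0" if "hi a" for a
  proof -
    have "ereal (- a) < left_deriv \<phi> 0"
      using that by (simp add: hi_def ereal_uminus_less_reorder flip: uminus_ereal.simps)
    then obtain t where "t < 0" "\<phi> t < ereal (- a * t)" using left_deriv_greaterD by blast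
    then show ?thesis
      using sharp_null_upper_local_dim_greater[OF assms(1) \<mu> assms(3)] B_le le_less_trans by blast
  qed
  \<comment> \<open>At a point outside \<open>X\<close> some rational lies strictly between the
    local dimension and the bound it violates.\<close>
  let ?Lo = "\<Union>q\<in>{q. lo (real_of_rat q)}. {x \<in> supp \<mu>. lower_local_dim \<mu> x < ereal (real_of_rat q)}"
  let ?Hi = "\<Union>q\<in>{q. hi (real_of_rat q)}. {x \<in> supp \<mu>. ereal (real_of_rat q) < upper_local_dim \<mu> x}"
  have "sharp \<nu> (supp \<mu> - X) = 0"
  proof (rule sharp_Un_null)
    show "sharp \<nu> ?Lo = 0"
      by (rule sharp_null_UN_rat) (rule lo)
    show "sharp \<nu> ?Hi = 0"
      by (rule sharp_null_UN_rat) (rule hi)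
    show "supp \<mu> - X \<subseteq> ?Lo \<union> ?Hi"
    proof
      fix x assume "x \<in> supp \<mu> - X"
      then have x: "x \<in> supp \<mu>"
        and "lower_local_dim \<mu> x < - right_deriv \<phi> 0 \<or> - left_deriv \<phi> 0 < upper_local_dim \<mu> x"
        by (auto simp: assms(7) level_set_def not_le)
      then show "x \<in> ?Lo \<union> ?Hi"
        by (elim disjE) (use ereal_dense3 in \<open>force simp: lo_def hi_def\<close>)+
    qed
  qed
  \<comment> \<open>Were \<open>X\<close> null as well, so would be
    \<open>supp \<mu>\<close>.\<close>
  then have "sharp \<nu> X \<noteq> 0"
    using sharp_Un_null[of \<nu> X "supp \<mu> - X" "supp \<mu>"] assms(6) by auto
  then show ?thesis
    using hausdorff_dim_ge_INF_lower_local_dim[OF assms(3)]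
      packing_dim_ge_INF_upper_local_dim[OF assms(1,3)] by blast
qed

end
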